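(* Let $X$ be a path connected space and let $n \geq 1$ be an integer. Then $\mathrm{TC}_n(X) \le \mathrm{TC}_{n+1}(X)$.
   Context: A fibration is a map with the homotopy lifting property. The Schwarz genus of a fibration $p: E \to B$ is the minimum number $k$ such that there exists an open covering $U_1, \ldots, U_k$ of $B$ where each $U_i$ admits a continuous map $s_i: U_i \to E$ with $p s_i(b) = b$ for all $b \in U_i$ (the genus is $\infty$ if no such $k$ exists). Let $J_n$ denote the wedge of $n$ closed intervals $[0,1]_i$, $i=1,\ldots,n$, where the zero points $0_i \in [0,1]_i$ are identified; let $1_i \in [0,1]_i$ be the unit. For a path connected space $X$ set $T_n(X) := X^{J_n}$ (the space of continuous maps $J_n \to X$), and let $e_n: T_n(X) \to X^n$ be the fibration $e_n(f) = (f(1_1), \ldots, f(1_n))$. The higher topological complexity $\mathrm{TC}_n(X)$ is defined to be the Schwarz genus of $e_n$. *)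

theory Defs
  imports "HOL-Analysis.Analysis" "HOL-Library.Extended_Nat"
begin

definition quotient_topology :: "'a topology \<Rightarrow> ('a \<times> 'a) set \<Rightarrow> 'a set topology" where
  "quotient_topology X r =
     topology (\<lambda>U. U \<subseteq> topspace X // r \<and> openin X {x \<in> topspace X. r `` {x} \<in> U})"

lemma openin_quotient_topology:
  "openin (quotient_topology X r) U \<longleftrightarrow>
     U \<subseteq> topspace X // r \<and> openin X {x \<in> topspace X. r `` {x} \<in> U}"
proof -
  have 1: "{x \<in> topspace X. r `` {x} \<in> S \<inter> T} =
           {x \<in> topspace X. r `` {x} \<in> S} \<inter> {x \<in> topspace X. r `` {x} \<in> T}" for S T
    by auto
  have 2: "{x \<in> topspace X. r `` {x} \<in> \<Union>\<K>} =
           \<Union>((\<lambda>S. {x \<in> topspace X. r `` {x} \<in> S}) ` \<K>)" for \<K>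
    by auto
  have "istopology (\<lambda>U. U \<subseteq> topspace X // r \<and> openin X {x \<in> topspace X. r `` {x} \<in> U})"
    unfolding istopology_def 1 2 by (auto intro: openin_Int openin_Union)
  then show ?thesis
    by (simp add: quotient_topology_def topology_inverse')
qed

lemma topspace_quotient_topology [simp]:
  "topspace (quotient_topology X r) = topspace X // r"
proof -
  have "{x \<in> topspace X. r `` {x} \<in> topspace X // r} = topspace X"
    by (auto intro: quotientI)
  then have "openin (quotient_topology X r) (topspace X // r)"
    by (simp add: openin_quotient_topology)
  moreover have "topspace (quotient_topology X r) \<subseteq> topspace X // r"
    using openin_topspace[of "quotient_topology X r"] openin_quotient_topology by blast
  ultimately show ?thesis
    by (meson openin_subset subset_antisym)
qed

lemma quotient_map_quotient_topology:
  "quotient_map X (quotient_topology X r) (\<lambda>x. r `` {x})"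
  by (auto simp: quotient_map_def openin_quotient_topology quotient_def)

definition intervals_sum :: "nat \<Rightarrow> (nat \<times> real) topology" where
  "intervals_sum n = sum_topology (\<lambda>i. top_of_set {0..1}) {1..n}"

definition wedge_rel :: "nat \<Rightarrow> ((nat \<times> real) \<times> (nat \<times> real)) set" where
  "wedge_rel n = {(p, q). p \<in> topspace (intervals_sum n) \<and> q \<in> topspace (intervals_sum n)
                    \<and> (p = q \<or> snd p = 0 \<and> snd q = 0)}"

lemma equiv_wedge_rel: "equiv (topspace (intervals_sum n)) (wedge_rel n)"
  by (rule equivI) (auto simp: wedge_rel_def refl_on_def sym_def trans_def)

definition J :: "nat \<Rightarrow> (nat \<times> real) set topology" where
  "J n = quotient_topology (intervals_sum n) (wedge_rel n)"

definition J_unit :: "nat \<Rightarrow> nat \<Rightarrow> (nat \<times> real) set" where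
  "J_unit n i = wedge_rel n `` {(i, 1)}"

text \<open>Continuous maps are represented by functions that are \<^const>\<open>undefined\<close> outside the
  domain space, so that distinct elements differ as maps.\<close>

definition cmaps :: "'a topology \<Rightarrow> 'b topology \<Rightarrow> ('a \<Rightarrow> 'b) set" where
  "cmaps X Y = {f \<in> extensional (topspace X). continuous_map X Y f}"

definition compact_open_topology :: "'a topology \<Rightarrow> 'b topology \<Rightarrow> ('a \<Rightarrow> 'b) topology" where
  "compact_open_topology X Y =
     topology_generated_by {{f \<in> cmaps X Y. f ` K \<subseteq> U} | K U. compactin X K \<and> openin Y U}"

lemma topspace_compact_open_topology [simp]:
  "topspace (compact_open_topology X Y) = cmaps X Y"
proof -
  have "cmaps X Y \<in> {{f \<in> cmaps X Y. f ` K \<subseteq> U} | K U. compactin X K \<and> openin Y U}"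
    by (intro CollectI exI[of _ "{}"]) auto
  then show ?thesis
    unfolding compact_open_topology_def topology_generated_by_topspace by blast
qed

definition T_space :: "nat \<Rightarrow> 'a topology \<Rightarrow> ((nat \<times> real) set \<Rightarrow> 'a) topology" where
  "T_space n X = compact_open_topology (J n) X"

definition X_power :: "nat \<Rightarrow> 'a topology \<Rightarrow> (nat \<Rightarrow> 'a) topology" where
  "X_power n X = product_topology (\<lambda>_. X) {1..n}"

definition e_map :: "nat \<Rightarrow> ((nat \<times> real) set \<Rightarrow> 'a) \<Rightarrow> (nat \<Rightarrow> 'a)" where
  "e_map n f = (\<lambda>i\<in>{1..n}. f (J_unit n i))"

text \<open>The homotopy lifting property plays no part in the formula for the genus, which is
  therefore stated for an arbitrary \<open>p\<close>. The infimum of the empty set is \<open>\<infinity>\<close>.\<close>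

definition schwarz_genus :: "'e topology \<Rightarrow> 'b topology \<Rightarrow> ('e \<Rightarrow> 'b) \<Rightarrow> enat" where
  "schwarz_genus E B p =
     Inf {enat k | k. \<exists>U :: nat \<Rightarrow> 'b set.
            (\<forall>i\<in>{1..k}. openin B (U i)) \<and> (\<Union>i\<in>{1..k}. U i) = topspace B \<and>
            (\<forall>i\<in>{1..k}. \<exists>s. continuous_map (subtopology B (U i)) E s \<and> (\<forall>b\<in>U i. p (s b) = b))}"

definition TC :: "nat \<Rightarrow> 'a topology \<Rightarrow> enat" where
  "TC n X = schwarz_genus (T_space n X) (X_power n X) (e_map n)"

end

theory Submission
  imports Defs
begin

text \<open>Adding a leg to the wedge embeds \<open>J n\<close> into \<open>J (n + 1)\<close>, and restriction along this embedding
  is a continuous map \<open>T_space (n + 1) X \<rightarrow> T_space n X\<close>. It covers the projection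
  \<open>X_power (n + 1) X \<rightarrow> X_power n X\<close>, which has the section
  \<open>(x\<^sub>1, \<dots>, x\<^sub>n) \<mapsto> (x\<^sub>1, \<dots>, x\<^sub>n, x\<^sub>1)\<close>. So a cover with local sections of
  \<open>e_map (n + 1)\<close> pulls back to one of \<open>e_map n\<close> with the same number of sets.\<close>

text \<open>Open sets and local sections pull back along \<open>\<phi>\<close>: a section
  \<open>s\<close> over \<open>U i\<close> gives \<open>\<psi> \<circ> s \<circ> \<phi>\<close> over
  the preimage of \<open>U i\<close>. Since \<open>compat\<close> concerns only points
  \<open>e\<close> lying over \<open>\<phi> b\<close>, no map from \<open>B\<close> to
  \<open>B'\<close> has to be named.\<close>

lemma schwarz_genus_mono:
  assumes \<phi>: "continuous_map B' B \<phi>" and \<psi>: "continuous_map E E' \<psi>"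
    and compat: "\<And>b e. b \<in> topspace B' \<Longrightarrow> e \<in> topspace E \<Longrightarrow> p e = \<phi> b \<Longrightarrow> p' (\<psi> e) = b"
  shows "schwarz_genus E' B' p' \<le> schwarz_genus E B p"
  unfolding schwarz_genus_def
\<comment> \<open>Every \<open>k\<close> admissible for \<open>p\<close> is shown admissible for
  \<open>p'\<close>; comparing infima of sets also covers the value \<infinity>.\<close>
proof (rule Inf_superset_mono, rule subsetI)
  fix c
  assume "c \<in> {enat k | k. \<exists>U. (\<forall>i\<in>{1..k}. openin B (U i)) \<and> (\<Union>i\<in>{1..k}. U i) = topspace B \<and>
      (\<forall>i\<in>{1..k}. \<exists>s. continuous_map (subtopology B (U i)) E s \<and> (\<forall>b\<in>U i. p (s b) = b))}"
  then obtain k U where c: "c = enat k" and opn: "\<forall>i\<in>{1..k}. openin B (U i)"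
    and cover: "(\<Union>i\<in>{1..k}. U i) = topspace B"
    and sec: "\<forall>i\<in>{1..k}. \<exists>s. continuous_map (subtopology B (U i)) E s \<and> (\<forall>b\<in>U i. p (s b) = b)"
    by (elim CollectE exE conjE)
  define V where "V i = {b \<in> topspace B'. \<phi> b \<in> U i}" for i
  have sections: "\<exists>s. continuous_map (subtopology B' (V i)) E' s \<and> (\<forall>b\<in>V i. p' (s b) = b)"
    if i: "i \<in> {1..k}" for i
  proof -
    obtain s where s: "continuous_map (subtopology B (U i)) E s" "\<forall>b\<in>U i. p (s b) = b"
      using bspec[OF sec i] by (elim exE conjE)
    have "continuous_map (subtopology B' (V i)) (subtopology B (U i)) \<phi>"
      using \<phi> by (auto simp: V_def continuous_map_in_subtopology continuous_map_from_subtopology)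
    then have "continuous_map (subtopology B' (V i)) E' (\<psi> \<circ> s \<circ> \<phi>)"
      using s(1) \<psi> by (intro continuous_map_compose[of _ _ \<phi>] continuous_map_compose[of _ _ s])
    moreover have "p' ((\<psi> \<circ> s \<circ> \<phi>) b) = b" if "b \<in> V i" for b
    proof -
      have b: "b \<in> topspace B'" "\<phi> b \<in> U i"
        using that by (auto simp: V_def)
      then have "\<phi> b \<in> topspace (subtopology B (U i))"
        using \<phi> by (auto simp: continuous_map_def)
      then have "s (\<phi> b) \<in> topspace E"
        using s(1) by (auto simp: continuous_map_def)
      then show ?thesis
        using compat[OF b(1), of "s (\<phi> b)"] b(2) s(2) by simp
    qed
    ultimately show ?thesis
      by (intro exI[of _ "\<psi> \<circ> s \<circ> \<phi>"] conjI ballI)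
  qed
  have openV: "openin B' (V i)" if "i \<in> {1..k}" for i
    unfolding V_def using \<phi> bspec[OF opn that] by (rule openin_continuous_map_preimage)
  have coverV: "(\<Union>i\<in>{1..k}. V i) = topspace B'"
  proof -
    have "\<phi> b \<in> (\<Union>i\<in>{1..k}. U i)" if "b \<in> topspace B'" for b
      using \<phi> that unfolding cover by (auto simp: continuous_map_def)
    then show ?thesis by (auto simp: V_def)
  qed
  show "c \<in> {enat k | k. \<exists>U. (\<forall>i\<in>{1..k}. openin B' (U i)) \<and> (\<Union>i\<in>{1..k}. U i) = topspace B' \<and>
      (\<forall>i\<in>{1..k}. \<exists>s. continuous_map (subtopology B' (U i)) E' s \<and> (\<forall>b\<in>U i. p' (s b) = b))}"
    by (intro CollectI exI[of _ k] exI[of _ V] conjI ballI c openV coverV sections)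
qed

text \<open>The subbasic set of \<open>K\<close> and \<open>U\<close> pulls back to that of
  \<open>h\<close> K\<open>and\<close>U\<open>, and\<close>h \<open>K\<close> is again compact. The
  \<open>restrict\<close> is there because elements of \<open>cmaps\<close> are extensional.\<close>

lemma continuous_map_compact_open_precompose:
  assumes h: "continuous_map X X' h"
  shows "continuous_map (compact_open_topology X' Y) (compact_open_topology X Y)
           (\<lambda>f. restrict (f \<circ> h) (topspace X))"
proof -
  have maps: "restrict (f \<circ> h) (topspace X) \<in> cmaps X Y" if "f \<in> cmaps X' Y" for f
  proof -
    have "continuous_map X Y (f \<circ> h)"
      using that h by (auto simp: cmaps_def intro: continuous_map_compose)
    then have "continuous_map X Y (restrict (f \<circ> h) (topspace X))"
      by (rule continuous_map_eq) simp
    then show ?thesis by (simp add: cmaps_def)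
  qed
  show ?thesis
    unfolding compact_open_topology_def[of X Y]
  proof (rule continuous_on_generated_topo)
    fix W assume "W \<in> {{f \<in> cmaps X Y. f ` K \<subseteq> U} | K U. compactin X K \<and> openin Y U}"
    then obtain K U where K: "compactin X K" and U: "openin Y U"
      and W: "W = {f \<in> cmaps X Y. f ` K \<subseteq> U}" by blast
    have KX: "K \<subseteq> topspace X"
      using K by (rule compactin_subset_topspace)
    \<comment> \<open>As \<open>K\<close> lies in \<open>topspace X\<close>, the restriction leaves
      the values on \<open>K\<close> unchanged.\<close>
    have "(\<lambda>f. restrict (f \<circ> h) (topspace X)) -` W \<inter> topspace (compact_open_topology X' Y)
        = {f \<in> cmaps X' Y. f ` (h ` K) \<subseteq> U}"
      using KX maps by (auto simp: W image_subset_iff subset_iff)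
    moreover have "openin (compact_open_topology X' Y) {f \<in> cmaps X' Y. f ` (h ` K) \<subseteq> U}"
      unfolding compact_open_topology_def
      by (rule topology_generated_by_Basis) (use image_compactin[OF K h] U in blast)
    ultimately show "openin (compact_open_topology X' Y)
        ((\<lambda>f. restrict (f \<circ> h) (topspace X)) -` W \<inter> topspace (compact_open_topology X' Y))"
      by simp
  next
    have "(\<lambda>f. restrict (f \<circ> h) (topspace X)) ` topspace (compact_open_topology X' Y)
        \<subseteq> topspace (compact_open_topology X Y)"
      using maps by auto
    then show "(\<lambda>f. restrict (f \<circ> h) (topspace X)) ` topspace (compact_open_topology X' Y)
        \<subseteq> \<Union>{{f \<in> cmaps X Y. f ` K \<subseteq> U} | K U. compactin X K \<and> openin Y U}"
      unfolding compact_open_topology_def[of X Y] topology_generated_by_topspace .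
  qed
qed

text \<open>A class for \<open>m\<close> is a single point or the set of all zero points of the
  \<open>m\<close> legs, so its members share one class for \<open>n\<close>. Hence taking images of
  classes under \<open>wedge_rel n\<close> is a well-defined map from \<open>J m\<close> to
  \<open>J n\<close>.\<close>

lemma wedge_rel_Image_class:
  assumes "m \<le> n" and "p \<in> topspace (intervals_sum m)"
  shows "wedge_rel n `` (wedge_rel m `` {p}) = wedge_rel n `` {p}"
proof
  show "wedge_rel n `` (wedge_rel m `` {p}) \<subseteq> wedge_rel n `` {p}"
    using assms by (auto simp: wedge_rel_def intervals_sum_def)
  have "p \<in> wedge_rel m `` {p}"
    using assms(2) by (simp add: wedge_rel_def)
  then show "wedge_rel n `` {p} \<subseteq> wedge_rel n `` (wedge_rel m `` {p})"
    by blast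
qed

lemma continuous_map_intervals_sum_inclusion:
  assumes "m \<le> n"
  shows "continuous_map (intervals_sum m) (intervals_sum n) id"
proof -
  have "openin (intervals_sum m) {p \<in> topspace (intervals_sum m). id p \<in> U}"
    if U: "openin (intervals_sum n) U" for U
    unfolding intervals_sum_def openin_sum_topology
  proof (intro conjI ballI)
    fix i assume i: "i \<in> {1..m}"
    have "openin (top_of_set {0..1}) {x. (i, x) \<in> U}"
      using U i assms by (simp add: intervals_sum_def openin_sum_topology)
    then have "openin (top_of_set {0..1}) ({0..1} \<inter> {x. (i, x) \<in> U})"
      by (metis openin_Int openin_topspace topspace_euclidean_subtopology)
    moreover have "{x. (i, x) \<in> {p \<in> topspace (sum_topology (\<lambda>i. top_of_set {0..1}) {1..m}). id p \<in> U}}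
        = {0..1} \<inter> {x. (i, x) \<in> U}"
      using i by auto
    ultimately show "openin (top_of_set {0..1})
        {x. (i, x) \<in> {p \<in> topspace (sum_topology (\<lambda>i. top_of_set {0..1}) {1..m}). id p \<in> U}}"
      by simp
  qed auto
  moreover have "id \<in> topspace (intervals_sum m) \<rightarrow> topspace (intervals_sum n)"
    using assms by (auto simp: intervals_sum_def)
  ultimately show ?thesis
    by (simp add: continuous_map_def)
qed

text \<open>By the universal property of the quotient, continuity is tested after composing with the
  projection onto \<open>J m\<close>; the composite is the inclusion of disjoint sums followed by
  the projection onto \<open>J n\<close>.\<close>

lemma continuous_map_J_inclusion:
  assumes "m \<le> n"
  shows "continuous_map (J m) (J n) (\<lambda>C. wedge_rel n `` C)"
proof -
  have "continuous_map (intervals_sum m) (J n) ((\<lambda>p. wedge_rel n `` {p}) \<circ> id)"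
    unfolding J_def
    by (intro continuous_map_compose[OF continuous_map_intervals_sum_inclusion[OF assms]]
        quotient_imp_continuous_map quotient_map_quotient_topology)
  then have "continuous_map (intervals_sum m) (J n)
      ((\<lambda>C. wedge_rel n `` C) \<circ> (\<lambda>p. wedge_rel m `` {p}))"
    by (rule continuous_map_eq) (simp add: wedge_rel_Image_class[OF assms])
  then show ?thesis
    unfolding J_def[of m]
    by (rule continuous_compose_quotient_map[OF quotient_map_quotient_topology])
qed

lemma J_unit_in_J:
  assumes "i \<in> {1..n}"
  shows "J_unit n i \<in> topspace (J n)"
  using assms unfolding J_unit_def J_def topspace_quotient_topology
  by (intro quotientI) (simp add: intervals_sum_def)

lemma J_inclusion_J_unit:
  assumes "m \<le> n" and "i \<in> {1..m}"
  shows "wedge_rel n `` (J_unit m i) = J_unit n i"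
  unfolding J_unit_def
  by (rule wedge_rel_Image_class) (use assms in \<open>auto simp: intervals_sum_def\<close>)

text \<open>Target coordinates beyond \<open>m\<close> are padded with the first one, which exists
  because \<open>1 \<le> m\<close>.\<close>

lemma continuous_map_X_power_repeat_first:
  assumes "1 \<le> m"
  shows "continuous_map (X_power m X) (X_power n X)
           (\<lambda>b. \<lambda>i\<in>{1..n}. b (if i \<le> m then i else 1))"
  unfolding X_power_def continuous_map_componentwise
  using assms by (auto intro!: continuous_map_product_projection)

lemma TC_mono:
  assumes "1 \<le> m" and "m \<le> n"
  shows "TC m X \<le> TC n X"
  unfolding TC_def
proof (rule schwarz_genus_mono)
  show "continuous_map (X_power m X) (X_power n X)
          (\<lambda>b. \<lambda>i\<in>{1..n}. b (if i \<le> m then i else 1))"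
    using assms(1) by (rule continuous_map_X_power_repeat_first)
  show "continuous_map (T_space n X) (T_space m X)
          (\<lambda>f. restrict (f \<circ> (\<lambda>C. wedge_rel n `` C)) (topspace (J m)))"
    unfolding T_space_def
    by (intro continuous_map_compact_open_precompose continuous_map_J_inclusion assms(2))
next
  fix b f
  assume b: "b \<in> topspace (X_power m X)"
    and e: "e_map n f = (\<lambda>i\<in>{1..n}. b (if i \<le> m then i else 1))"
  have "f (J_unit n i) = b i" if "i \<in> {1..m}" for i
    using fun_cong[OF e, of i] that assms(2) by (simp add: e_map_def)
  \<comment> \<open>Equality of tuples as functions also needs agreement outside
    \<open>{1..m}\<close>, where both sides are \<open>undefined\<close>.\<close>
  moreover have "b \<in> extensional {1..m}"
    using b by (simp add: X_power_def PiE_def)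
  ultimately show "e_map m (restrict (f \<circ> (\<lambda>C. wedge_rel n `` C)) (topspace (J m))) = b"
    using assms(2)
    by (intro extensionalityI[of _ "{1..m}"])
       (auto simp: e_map_def J_unit_in_J J_inclusion_J_unit)
qed

theorem proposition3p3:
  fixes X :: "'a topology" and n :: nat
  assumes "path_connected_space X" and "n \<ge> 1"
  shows "TC n X \<le> TC (n + 1) X"
  using assms(2) by (simp add: TC_mono)

end
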